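(* Let $0<p<1$, $0<\lambda\le 1$, and let $f\in\mathcal{V}_p(\lambda)$ have the Taylor expansion $f(z)=z+\sum_{n=2}^{\infty}a_n(f)z^n$ for $|z|<p$. Then for every $n\ge 3$, $$|a_n(f)|\le \frac{1}{p^{n-1}}+\left(\sum_{k=1}^{n-1}\lambda^{2k}p^{2k}\right)^{1/2}\left(\sum_{k=1}^{n-1}\frac{1}{p^{2(n-k-1)}}\right)^{1/2},$$ and for every $n\ge 2$, $$\left|a_{n+1}(f)-\frac{a_n(f)}{p}\right|\le \lambda p.$$
   Context: $\mathbb{D}=\{z\in\mathbb{C}:|z|<1\}$. For $p\in(0,1)$, $\mathcal{A}(p)$ is the class of functions $f$ on $\mathbb{D}$ that are analytic in $\mathbb{D}\setminus\{p\}$, have a simple pole at $z=p$, and satisfy $f(0)=0=f'(0)-1$. For $f\in\mathcal{A}(p)$ set $U_f(z)=\left(\frac{z}{f(z)}\right)^2 f'(z)-1$ (with removable singularities, at $z=0$ and $z=p$, removed). For $0<\lambda\le 1$, $\mathcal{V}_p(\lambda)=\{f\in\mathcal{A}(p): |U_f(z)|<\lambda \text{ for all } z\in\mathbb{D}\}$. Each $f\in\mathcal{V}_p(\lambda)$ is analytic in the disc $|z|<p$, so it has a Taylor expansion there about $0$, whose coefficients are denoted $a_n(f)$. *)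

theory Defs
  imports "HOL-Complex_Analysis.Complex_Analysis"
begin

(* Meromorphic functions on the unit disc are represented by total functions on the complex
   numbers. The value at the pole p and the values outside the disc are arbitrary, and nothing
   below depends on them. *)
definition class_A :: "real \<Rightarrow> (complex \<Rightarrow> complex) set" where
  "class_A p = {f. f analytic_on (ball 0 1 - {of_real p})
                 \<and> is_pole f (of_real p) \<and> zorder f (of_real p) = -1
                 \<and> f 0 = 0 \<and> deriv f 0 = 1}"

(* Singularities are removed at 0 and p only. At any further zero of f in the disc the
   singularity is a genuine pole; there division by zero makes the value -1, so such an f is
   not admitted to class_V below (as lam <= 1). *)
definition U_op :: "real \<Rightarrow> (complex \<Rightarrow> complex) \<Rightarrow> complex \<Rightarrow> complex" where
  "U_op p f z =
     (let g = (\<lambda>w. (w / f w)\<^sup>2 * deriv f w - 1)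
      in if z = 0 \<or> z = of_real p then remove_sings g z else g z)"

definition class_V :: "real \<Rightarrow> real \<Rightarrow> (complex \<Rightarrow> complex) set" where
  "class_V p lam = {f \<in> class_A p. \<forall>z\<in>ball 0 1. norm (U_op p f z) < lam}"

definition taylor_coeff :: "(complex \<Rightarrow> complex) \<Rightarrow> nat \<Rightarrow> complex" where
  "taylor_coeff f n = fps_nth (fps_expansion f 0) n"

end

theory Submission
  imports Defs
begin

text \<open>
  The function \<open>G(z) = z / f(z)\<close> is holomorphic on the unit disc, with \<open>G(0) = 1\<close>, \<open>G(p) = 0\<close> and
  \<open>U\<^sub>f = G - z G' - 1\<close>. Writing \<open>G = 1 + z Q\<close> gives \<open>U\<^sub>f = - z\<^sup>2 Q'\<close>, so \<open>|Q'| \<le> \<lambda>\<close> by the maximum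
  principle, and the difference quotient of \<open>Q\<close> at \<open>p\<close> is bounded by \<open>\<lambda>\<close>. This yields
  \<open>(1 - z/p) f(z) = z F(z)\<close> with \<open>F = 1 / (1 - z \<phi>)\<close> and \<open>|\<phi>| \<le> \<lambda> p\<close>, so the coefficients of \<open>F\<close> are
  \<open>c\<^sub>n = a\<^bsub>n+1\<^esub> - a\<^sub>n / p\<close>. Multiplication by a function bounded by \<open>M\<close>, followed by truncation, has
  norm at most \<open>M\<close> on square-summable coefficient sequences. Applied to \<open>F = 1 + z \<phi> F\<close> (Clunie's
  method), this bounds \<open>\<Sum>|c\<^sub>k|\<^sup>2\<close> by \<open>\<Sum>(\<lambda> p)\<^bsup>2k\<^esup>\<close>, and the first estimate follows by Cauchy-Schwarz;
  applied to a Moebius image of \<open>F\<close>, it gives \<open>|c\<^sub>n| \<le> \<lambda> p\<close>.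
\<close>

section \<open>Mean squares on circles and coefficient sums of products\<close>

lemma has_fps_expansion_fps_of_poly:
  fixes q :: "complex poly"
  shows "poly q has_fps_expansion fps_of_poly q"
  by (auto simp: has_fps_expansion_def)

text \<open>Cauchy's formula for the \<open>k\<close>-th coefficient, rewritten: on the circle
  \<open>cnj u = r^2 / u\<close>, which turns \<open>1 / u ^ k\<close> into a conjugate power, and
  \<open>du / (2 pi i u) = dt\<close>.\<close>

lemma has_integral_circle_fps_nth:
  fixes h :: "complex \<Rightarrow> complex"
  assumes h: "h holomorphic_on ball 0 1" and A: "h has_fps_expansion A"
    and r: "0 < r" "r < 1"
  shows "((\<lambda>t. h (circlepath 0 r t) * cnj (circlepath 0 r t ^ k))
           has_integral (fps_nth A k * of_real (r ^ (2 * k)))) {0..1}"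
proof -
  let ?e = "circlepath 0 r"
  have sub: "cball 0 r \<subseteq> ball (0::complex) 1" using r by auto
  have "((\<lambda>u. h u / (u - 0) ^ Suc k) has_contour_integral
          ((2 * pi * \<i>) / fact k * (deriv ^^ k) h 0)) ?e"
    using r sub
    by (intro Cauchy_has_contour_integral_higher_derivative_circlepath
              holomorphic_on_imp_continuous_on holomorphic_on_subset[OF h]) auto
  moreover have "(deriv ^^ k) h 0 / fact k = fps_nth A k"
    using fps_nth_fps_expansion[OF A] by simp
  ultimately have "((\<lambda>u. h u / u ^ Suc k) has_contour_integral
          ((2 * pi * \<i>) * fps_nth A k)) ?e"
    by (simp add: field_simps)
  hence "((\<lambda>t. of_real (r ^ (2 * k)) / (2 * pi * \<i>) *
            (h (?e t) / ?e t ^ Suc k * vector_derivative ?e (at t within {0..1})))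
            has_integral (of_real (r ^ (2 * k)) / (2 * pi * \<i>) * ((2 * pi * \<i>) * fps_nth A k))) {0..1}"
    unfolding has_contour_integral_def by (rule has_integral_mult_right)
  thus ?thesis
  proof (rule has_integral_eq_rhs[OF has_integral_eq, rotated])
    fix t :: real assume t: "t \<in> {0..1}"
    have e: "?e t = r * exp (2 * of_real pi * \<i> * t)" by (simp add: circlepath)
    have n0: "?e t \<noteq> 0" using r by (simp add: e)
    have "norm (?e t) = r" using r by (simp add: e norm_mult)
    hence "cnj (?e t) * ?e t = of_real (r\<^sup>2)"
      by (metis complex_norm_square mult.commute of_real_power)
    hence "cnj (?e t) = of_real (r\<^sup>2) / ?e t" using n0 by (simp add: field_simps)
    hence c: "cnj (?e t ^ k) = of_real (r ^ (2 * k)) / ?e t ^ k"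
      by (simp add: power_divide power_mult)
    have v: "vector_derivative ?e (at t within {0..1}) = 2 * pi * \<i> * ?e t"
      using t by (subst vector_derivative_circlepath01) (auto simp: e)
    show "of_real (r ^ (2 * k)) / (2 * pi * \<i>) *
            (h (?e t) / ?e t ^ Suc k * vector_derivative ?e (at t within {0..1}))
          = h (?e t) * cnj (?e t ^ k)"
      unfolding v c using n0 by (simp add: field_simps)
  qed (simp add: field_simps)
qed

text \<open>The inner product with a polynomial involves only finitely many coefficient integrals,
  so no series is interchanged with the integral.\<close>

lemma has_integral_circle_inner_poly:
  fixes h :: "complex \<Rightarrow> complex"
  assumes h: "h holomorphic_on ball 0 1" and A: "h has_fps_expansion A"
    and r: "0 < r" "r < 1" and "degree q \<le> m"
  shows "((\<lambda>t. Re (h (circlepath 0 r t) * cnj (poly q (circlepath 0 r t))))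
           has_integral (\<Sum>k\<le>m. Re (fps_nth A k * cnj (coeff q k)) * r ^ (2 * k))) {0..1}"
proof -
  let ?e = "circlepath 0 r"
  have "((\<lambda>t. \<Sum>k\<le>m. cnj (coeff q k) * (h (?e t) * cnj (?e t ^ k))) has_integral
          (\<Sum>k\<le>m. cnj (coeff q k) * (fps_nth A k * of_real (r ^ (2 * k))))) {0..1}"
    using has_integral_circle_fps_nth[OF h A r]
    by (intro has_integral_sum has_integral_mult_right) auto
  moreover have "poly q z = (\<Sum>k\<le>m. coeff q k * z ^ k)" for z
    using assms(5) by (subst poly_altdef) (intro sum.mono_neutral_left, auto simp: coeff_eq_0)
  hence "(\<Sum>k\<le>m. cnj (coeff q k) * (h (?e t) * cnj (?e t ^ k))) = h (?e t) * cnj (poly q (?e t))" for t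
    by (simp add: sum_distrib_left mult_ac)
  ultimately have "((\<lambda>t. h (?e t) * cnj (poly q (?e t))) has_integral
          (\<Sum>k\<le>m. cnj (coeff q k) * (fps_nth A k * of_real (r ^ (2 * k))))) {0..1}"
    by simp
  from has_integral_linear[OF this bounded_linear_Re] show ?thesis
    by (simp add: o_def algebra_simps)
qed

lemma parseval_poly_circle:
  assumes "0 < r" "r < 1" "degree q \<le> m"
  shows "((\<lambda>t. (norm (poly q (circlepath 0 r t)))\<^sup>2)
           has_integral (\<Sum>k\<le>m. (norm (coeff q k))\<^sup>2 * r ^ (2 * k))) {0..1}"
proof -
  have "Re (x * cnj x) = (norm x)\<^sup>2" for x :: complex
    by (simp add: complex_mult_cnj cmod_power2)
  thus ?thesis
    using has_integral_circle_inner_poly[OF _ has_fps_expansion_fps_of_poly assms, of q]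
    by (simp add: holomorphic_intros)
qed

text \<open>The mean of \<open>|h - q|^2\<close> is nonnegative for the Taylor polynomial
  \<open>q\<close> of \<open>h\<close>. The cross term and the square of \<open>q\<close> both
  reduce to the partial sum, so this mean equals \<open>I - ?S\<close>.\<close>

lemma bessel_circle:
  fixes h :: "complex \<Rightarrow> complex"
  assumes h: "h holomorphic_on ball 0 1" and A: "h has_fps_expansion A"
    and r: "0 < r" "r < 1"
    and I: "((\<lambda>t. (norm (h (circlepath 0 r t)))\<^sup>2) has_integral I) {0..1}"
  shows "(\<Sum>k\<le>m. (norm (fps_nth A k))\<^sup>2 * r ^ (2 * k)) \<le> I"
proof -
  let ?e = "circlepath 0 r"
  let ?S = "\<Sum>k\<le>m. (norm (fps_nth A k))\<^sup>2 * r ^ (2 * k)"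
  define q where "q = (\<Sum>k\<le>m. monom (fps_nth A k) k)"
  have q: "coeff q k = fps_nth A k" if "k \<le> m" for k
    using that by (simp add: q_def coeff_sum)
  have deg: "degree q \<le> m"
    unfolding q_def by (intro degree_sum_le) (auto intro: order_trans[OF degree_monom_le])
  have "((\<lambda>t. (norm (h (?e t)))\<^sup>2 - 2 * Re (h (?e t) * cnj (poly q (?e t)))
            + (norm (poly q (?e t)))\<^sup>2) has_integral (I - 2 * ?S + ?S)) {0..1}"
    using has_integral_circle_inner_poly[OF h A r deg] parseval_poly_circle[OF r deg]
    by (intro has_integral_add has_integral_diff has_integral_mult_right I)
       (simp_all add: q complex_mult_cnj cmod_power2)
  moreover have "(norm x)\<^sup>2 - 2 * Re (x * cnj y) + (norm y)\<^sup>2 = (norm (x - y))\<^sup>2" for x y :: complex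
    by (simp add: cmod_power2) (simp add: power2_eq_square algebra_simps)
  ultimately have "((\<lambda>t. (norm (h (?e t) - poly q (?e t)))\<^sup>2) has_integral (I - ?S)) {0..1}"
    by simp
  from has_integral_nonneg[OF this] show ?thesis by simp
qed

text \<open>On each circle, Bessel for the product, the pointwise bound by \<open>M\<close>, and
  Parseval for \<open>q\<close> combine to a weighted estimate; letting \<open>r\<close> tend to 1
  removes the weights.\<close>

lemma sum_norm_fps_nth_mult_poly_le:
  fixes \<phi> :: "complex \<Rightarrow> complex"
  assumes h: "\<phi> holomorphic_on ball 0 1" and A: "\<phi> has_fps_expansion A"
    and M: "\<And>z. z \<in> ball 0 1 \<Longrightarrow> norm (\<phi> z) \<le> M" and deg: "degree q \<le> d"
  shows "(\<Sum>k\<le>m. (norm (fps_nth (A * fps_of_poly q) k))\<^sup>2) \<le> M\<^sup>2 * (\<Sum>k\<le>d. (norm (coeff q k))\<^sup>2)"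
proof -
  let ?B = "A * fps_of_poly q"
  have le: "(\<Sum>k\<le>m. (norm (fps_nth ?B k))\<^sup>2 * r ^ (2 * k))
          \<le> M\<^sup>2 * (\<Sum>k\<le>d. (norm (coeff q k))\<^sup>2 * r ^ (2 * k))" if r: "0 < r" "r < 1" for r
  proof -
    let ?e = "circlepath 0 r" and ?h = "\<lambda>z. \<phi> z * poly q z"
    have hol: "?h holomorphic_on ball 0 1" by (intro holomorphic_intros h)
    have exp: "?h has_fps_expansion ?B"
      by (intro fps_expansion_intros A has_fps_expansion_fps_of_poly)
    have e: "?e t \<in> ball 0 1" for t using r by (simp add: circlepath norm_mult)
    have "continuous_on {0..1} ?e" by (simp add: path_def[symmetric])
    hence "(\<lambda>t. (norm (?h (?e t)))\<^sup>2) integrable_on {0..1}"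
      using e by (intro integrable_continuous_real continuous_intros
        continuous_on_compose2[OF holomorphic_on_imp_continuous_on[OF hol], of _ ?e]) auto
    then obtain I where I: "((\<lambda>t. (norm (?h (?e t)))\<^sup>2) has_integral I) {0..1}" by blast
    note bessel_circle[OF hol exp r I]
    also have "I \<le> M\<^sup>2 * (\<Sum>k\<le>d. (norm (coeff q k))\<^sup>2 * r ^ (2 * k))"
    proof (rule has_integral_le[OF I has_integral_mult_right[OF parseval_poly_circle[OF r deg]]])
      fix t :: real
      have "(norm (\<phi> (?e t)))\<^sup>2 \<le> M\<^sup>2" using M[OF e] by (intro power_mono) auto
      thus "(norm (?h (?e t)))\<^sup>2 \<le> M\<^sup>2 * (norm (poly q (?e t)))\<^sup>2"
        by (simp add: norm_mult power_mult_distrib mult_right_mono)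
    qed
    finally show ?thesis .
  qed
  have lim: "((\<lambda>r. \<Sum>k\<le>n. a k * r ^ (2 * k)) \<longlongrightarrow> (\<Sum>k\<le>n. a k)) (at_left 1)"
    for a :: "nat \<Rightarrow> real" and n
    by (rule tendsto_eq_intros refl | simp)+
  have "eventually (\<lambda>r. r \<in> {0<..<1::real}) (at_left 1)"
    by (rule eventually_at_left_real) simp
  hence ev: "eventually (\<lambda>r. (\<Sum>k\<le>m. (norm (fps_nth ?B k))\<^sup>2 * r ^ (2 * k))
          \<le> M\<^sup>2 * (\<Sum>k\<le>d. (norm (coeff q k))\<^sup>2 * r ^ (2 * k))) (at_left (1::real))"
    by eventually_elim (use le in auto)
  show ?thesis
    by (rule tendsto_le[OF _ tendsto_mult_left[OF lim] lim ev]) simp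
qed

section \<open>Coefficient bounds for the series \<open>F = 1 / (1 - X A)\<close>\<close>

text \<open>Since \<open>F - 1 = A * (X F)\<close>, its coefficients up to \<open>m\<close> depend
  only on those of \<open>X F\<close> up to \<open>m\<close>. Truncating \<open>X F\<close> there
  gives a polynomial to which the multiplier bound applies, and the resulting inequality is
  iterated.\<close>

lemma sum_norm_subordinate_coeff_le:
  fixes \<phi> :: "complex \<Rightarrow> complex"
  assumes "\<phi> holomorphic_on ball 0 1" and "\<phi> has_fps_expansion A"
    and "\<And>z. z \<in> ball 0 1 \<Longrightarrow> norm (\<phi> z) \<le> \<mu>"
    and F: "F = 1 + fps_X * A * F"
  shows "(\<Sum>k=1..m. (norm (fps_nth F k))\<^sup>2) \<le> (\<Sum>k=1..m. \<mu> ^ (2 * k))"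
proof -
  have F0: "fps_nth F 0 = 1" by (subst F) simp
  have step: "(\<Sum>k=1..m. (norm (fps_nth F k))\<^sup>2) \<le> \<mu>\<^sup>2 * (\<Sum>k<m. (norm (fps_nth F k))\<^sup>2)" for m
  proof -
    \<comment> \<open>The truncation of \<open>X F\<close> at degree \<open>m\<close>. The shift is
      essential: its norm involves \<open>F\<close> only up to index \<open>m - 1\<close>, which
      drives the induction.\<close>
    define q where "q = (\<Sum>k<m. monom (fps_nth F k) (Suc k))"
    have q: "coeff q k = fps_nth (fps_X * F) k" if "k \<le> m" for k
      using that by (cases k) (auto simp: q_def coeff_sum)
    have deg: "degree q \<le> m"
      unfolding q_def by (intro degree_sum_le) (auto intro: order_trans[OF degree_monom_le])
    have B: "fps_nth (A * fps_of_poly q) k = fps_nth (F - 1) k" if "k \<le> m" for k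
    proof -
      have "fps_nth (A * fps_of_poly q) k = fps_nth (A * (fps_X * F)) k"
        using that by (auto simp: fps_mult_nth q simp del: fps_X_mult_nth intro!: sum.cong)
      also have "A * (fps_X * F) = F - 1" by (subst (2) F) (simp add: mult_ac)
      finally show ?thesis .
    qed
    have "(\<Sum>k=1..m. (norm (fps_nth F k))\<^sup>2) = (\<Sum>k=1..m. (norm (fps_nth (A * fps_of_poly q) k))\<^sup>2)"
      by (intro sum.cong) (auto simp: B)
    also have "\<dots> \<le> (\<Sum>k\<le>m. (norm (fps_nth (A * fps_of_poly q) k))\<^sup>2)"
      by (intro sum_mono2) auto
    also have "\<dots> \<le> \<mu>\<^sup>2 * (\<Sum>k\<le>m. (norm (coeff q k))\<^sup>2)"
      by (rule sum_norm_fps_nth_mult_poly_le[OF assms(1-3) deg])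
    also have "(\<Sum>k\<le>m. (norm (coeff q k))\<^sup>2) = (\<Sum>k<m. (norm (fps_nth F k))\<^sup>2)"
      by (subst sum.atMost_shift) (auto simp: q)
    finally show ?thesis .
  qed
  show ?thesis
  proof (induction m)
    case (Suc m)
    have "(\<Sum>k=1..Suc m. (norm (fps_nth F k))\<^sup>2) \<le> \<mu>\<^sup>2 * (\<Sum>k<Suc m. (norm (fps_nth F k))\<^sup>2)"
      by (rule step)
    also have "(\<Sum>k<Suc m. (norm (fps_nth F k))\<^sup>2) = 1 + (\<Sum>k=1..m. (norm (fps_nth F k))\<^sup>2)"
      by (subst sum.lessThan_Suc_shift) (simp add: F0 sum.atLeast1_atMost_eq)
    also have "\<mu>\<^sup>2 * \<dots> \<le> \<mu>\<^sup>2 * (1 + (\<Sum>k=1..m. \<mu> ^ (2 * k)))"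
      using Suc by (intro mult_left_mono) auto
    also have "\<dots> = (\<Sum>k=1..Suc m. \<mu> ^ (2 * k))"
      by (induction m) (simp_all add: algebra_simps power2_eq_square)
    finally show ?case .
  qed auto
qed

text \<open>The multiplier \<open>(1 - \<mu>\<^sup>2) / (1 - z \<phi>(z)) - 1\<close> maps into the disc of radius
  \<open>\<mu>\<close>, because \<open>1 / (1 - \<zeta>)\<close> maps \<open>|\<zeta>| \<le> \<mu>\<close> onto the disc with centre \<open>1 / (1 - \<mu>\<^sup>2)\<close> and radius
  \<open>\<mu> / (1 - \<mu>\<^sup>2)\<close>. Testing it on \<open>1 - c X\<^sup>n\<close>, where \<open>c\<close> is the \<open>n\<close>-th coefficient of \<open>F\<close>, is optimal.\<close>
lemma norm_subordinate_coeff_le: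
  fixes \<phi> :: "complex \<Rightarrow> complex"
  assumes h: "\<phi> holomorphic_on ball 0 1" and A: "\<phi> has_fps_expansion A"
    and M: "\<And>z. z \<in> ball 0 1 \<Longrightarrow> norm (\<phi> z) \<le> \<mu>" and \<mu>: "0 \<le> \<mu>" "\<mu> < 1"
    and F: "F = 1 + fps_X * A * F" and n: "n \<ge> 1"
  shows "norm (fps_nth F n) \<le> \<mu>"
proof -
  let ?G = "\<lambda>z. complex_of_real (1 - \<mu>\<^sup>2) * (1 / (1 - z * \<phi> z)) - 1"
  define B where "B = fps_const (complex_of_real (1 - \<mu>\<^sup>2)) * F - 1"
  let ?c = "fps_nth F n"
  have F0: "fps_nth F 0 = 1" by (subst F) simp
  have le: "norm (z * \<phi> z) \<le> \<mu>" if "z \<in> ball 0 1" for z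
    using mult_mono[OF _ M[OF that], of "norm z" 1] that by (simp add: norm_mult)
  have nz: "1 - z * \<phi> z \<noteq> 0" if "z \<in> ball 0 1" for z
    using le[OF that] \<mu> by auto
  have F': "F = inverse (1 - fps_X * A)"
  proof -
    have "F - fps_X * A * F = 1" using F by (metis add_diff_cancel_right')
    hence "(1 - fps_X * A) * F = 1" by (simp add: algebra_simps)
    thus ?thesis by (rule fps_inverse_unique[symmetric])
  qed
  have "(\<lambda>z. 1 / (1 - z * \<phi> z)) has_fps_expansion F"
    unfolding F' divide_inverse mult_1_left
    by (intro fps_expansion_intros A) auto
  hence exp: "?G has_fps_expansion B" unfolding B_def by (intro fps_expansion_intros)
  have hol: "?G holomorphic_on ball 0 1" using nz by (intro holomorphic_intros h) auto
  have bd: "norm (?G z) \<le> \<mu>" if z: "z \<in> ball 0 1" for z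
  proof -
    define \<zeta> where "\<zeta> = z * \<phi> z"
    have \<zeta>: "1 - \<zeta> \<noteq> 0" "norm \<zeta> \<le> \<mu>" using nz[OF z] le[OF z] by (auto simp: \<zeta>_def)
    \<comment> \<open>Expanding both squares in the next inequality, the terms in
      \<open>Re \<zeta>\<close> cancel and exactly this remains.\<close>
    have "(norm \<zeta>)\<^sup>2 * (1 - \<mu>\<^sup>2) \<le> \<mu>\<^sup>2 * (1 - \<mu>\<^sup>2)"
      using \<zeta>(2) \<mu> by (intro mult_right_mono power_mono) (auto simp: power_le_one)
    hence "(norm (\<zeta> - \<mu>\<^sup>2))\<^sup>2 \<le> (\<mu> * norm (1 - \<zeta>))\<^sup>2"
      unfolding power_mult_distrib cmod_power2 by (simp add: power2_eq_square algebra_simps)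
    hence "norm (\<zeta> - \<mu>\<^sup>2) \<le> \<mu> * norm (1 - \<zeta>)"
      using \<mu> by (simp add: power2_le_iff_abs_le)
    moreover have eq: "?G z = (\<zeta> - \<mu>\<^sup>2) / (1 - \<zeta>)"
      using \<zeta>(1) unfolding \<zeta>_def[symmetric] by (simp add: field_simps)
    ultimately show ?thesis
      unfolding eq norm_divide using \<zeta>(1) by (simp add: divide_le_eq)
  qed
  define q where "q = 1 - monom ?c n"
  have deg: "degree q \<le> n"
    unfolding q_def by (intro degree_diff_le) (auto simp: degree_monom_le)
  have q: "fps_of_poly q = 1 - fps_const ?c * fps_X ^ n"
    by (simp add: q_def fps_of_poly_diff fps_of_poly_monom)
  have B0: "fps_nth (B * fps_of_poly q) 0 = - of_real (\<mu>\<^sup>2)"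
    using n by (simp add: F0 q B_def)
  have "B * fps_of_poly q = B - fps_const ?c * (B * fps_X ^ n)"
    unfolding q by (simp add: algebra_simps)
  \<comment> \<open>As \<open>B\<close> has constant term \<open>- \<mu>^2\<close> and
    \<open>n\<close>-th coefficient \<open>(1 - \<mu>^2) c\<close>, the two contributions add up to
    \<open>c\<close>.\<close>
  hence "fps_nth (B * fps_of_poly q) n = fps_nth B n - ?c * fps_nth B 0"
    by (simp add: fps_X_power_mult_right_nth)
  also have "\<dots> = ?c"
    using n by (simp add: B_def F0 algebra_simps)
  finally have Bn: "fps_nth (B * fps_of_poly q) n = ?c" .
  \<comment> \<open>Keeping only the indices \<open>0\<close> and \<open>n\<close> of the product
    gives \<open>\<mu>^4 + |c|^2 \<le> \<mu>^2 (1 + |c|^2)\<close>, and the factor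
    \<open>1 - \<mu>^2 > 0\<close> can then be cancelled.\<close>
  have "(norm (- complex_of_real (\<mu>\<^sup>2)))\<^sup>2 = \<mu> ^ 4"
    by (simp only: norm_minus_cancel norm_of_real power2_abs) simp
  moreover have "(\<Sum>k\<in>{0,n}. (norm (fps_nth (B * fps_of_poly q) k))\<^sup>2) =
      (norm (fps_nth (B * fps_of_poly q) 0))\<^sup>2 + (norm (fps_nth (B * fps_of_poly q) n))\<^sup>2"
    using n by (simp del: fps_mult_nth_0)
  ultimately have "\<mu> ^ 4 + (norm ?c)\<^sup>2 = (\<Sum>k\<in>{0,n}. (norm (fps_nth (B * fps_of_poly q) k))\<^sup>2)"
    by (simp only: B0 Bn)
  also have "\<dots> \<le> (\<Sum>k\<le>n. (norm (fps_nth (B * fps_of_poly q) k))\<^sup>2)"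
    by (intro sum_mono2) auto
  also have "\<dots> \<le> \<mu>\<^sup>2 * (\<Sum>k\<le>n. (norm (coeff q k))\<^sup>2)"
    by (rule sum_norm_fps_nth_mult_poly_le[OF hol exp bd deg])
  also have "(\<Sum>k\<le>n. (norm (coeff q k))\<^sup>2) = (\<Sum>k\<in>{0,n}. (norm (coeff q k))\<^sup>2)"
    by (intro sum.mono_neutral_right) (auto simp: q_def)
  also have "\<dots> = 1 + (norm ?c)\<^sup>2"
    using n by (simp add: q_def)
  finally have "(1 - \<mu>\<^sup>2) * (norm ?c)\<^sup>2 \<le> (1 - \<mu>\<^sup>2) * \<mu>\<^sup>2"
    by (simp add: algebra_simps power4_eq_xxxx power2_eq_square)
  moreover have "1 - \<mu>\<^sup>2 > 0" using \<mu> by (simp add: power_less_one_iff abs_square_less_1)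
  ultimately show ?thesis using \<mu> by (simp add: power2_le_iff_abs_le)
qed

section \<open>Holomorphy and factorization of \<open>z / f(z)\<close>\<close>

text \<open>The maximum principle on \<open>cball 0 r\<close> gives \<open>M / r^2\<close>, and
  \<open>r\<close> tends to 1. In the application the annulus avoids both \<open>0\<close> and
  \<open>p\<close>, so the values filled in there never have to be computed.\<close>

lemma norm_le_of_weighted_bound_near_boundary:
  fixes h :: "complex \<Rightarrow> complex"
  assumes h: "h holomorphic_on ball 0 1" and p: "p < 1"
    and le: "\<And>z. p < norm z \<Longrightarrow> norm z < 1 \<Longrightarrow> norm (z\<^sup>2 * h z) \<le> M" and z: "norm z < 1"
  shows "norm (h z) \<le> M"
proof -
  have "norm (h z) \<le> M / r\<^sup>2" if r: "0 < r" "p < r" "norm z < r" "r < 1" for r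
  proof (rule maximum_modulus_frontier[where f = h and \<xi> = z and S = "cball 0 r"])
    have "cball 0 r \<subseteq> ball (0::complex) 1" using r by auto
    hence hol: "h holomorphic_on cball 0 r" by (rule holomorphic_on_subset[OF h])
    show "h holomorphic_on interior (cball 0 r)"
      by (rule holomorphic_on_subset[OF hol interior_subset])
    show "continuous_on (closure (cball 0 r)) h"
      using holomorphic_on_imp_continuous_on[OF hol] by simp
    show "norm (h w) \<le> M / r\<^sup>2" if "w \<in> frontier (cball 0 r)" for w
    proof -
      have "norm w = r" using that r by simp
      thus ?thesis
        using le[of w] r by (simp add: norm_mult norm_power pos_le_divide_eq mult.commute)
    qed
    show "bounded (cball (0::complex) r)" by simp
    show "z \<in> cball 0 r" using r by simp
  qed
  moreover have "eventually (\<lambda>r. r \<in> {max 0 (max p (norm z))<..<1}) (at_left 1)"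
    by (rule eventually_at_left_real) (use p z in simp)
  ultimately have "eventually (\<lambda>r. norm (h z) \<le> M / r\<^sup>2) (at_left (1::real))"
    by (auto elim!: eventually_mono)
  moreover have "((\<lambda>r. M / r\<^sup>2) \<longlongrightarrow> M) (at_left (1::real))"
    by (rule tendsto_eq_intros refl | simp)+
  ultimately show ?thesis
    by (intro tendsto_lowerbound) auto
qed

text \<open>Two divided differences: \<open>Q\<close> at \<open>0\<close> for \<open>G\<close>, then
  \<open>H\<close> at \<open>p\<close> for \<open>Q\<close>. The zero of \<open>G\<close> at
  \<open>p\<close> forces \<open>Q(p) = -1/p\<close>, so \<open>G = 1 - z/p + z (z - p) H\<close>,
  in which \<open>1 - z/p\<close> factors out.\<close>

lemma factorization_of_bounded_defect:
  fixes G :: "complex \<Rightarrow> complex"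
  assumes G: "G holomorphic_on ball 0 1" "G 0 = 1" "G (of_real p) = 0"
    and p: "0 < p" "p < 1"
    and bd: "\<And>z. p < norm z \<Longrightarrow> norm z < 1 \<Longrightarrow> norm (G z - z * deriv G z - 1) \<le> M"
  obtains H where "H holomorphic_on ball 0 1" "\<And>z. z \<in> ball 0 1 \<Longrightarrow> norm (H z) \<le> M"
    "\<And>z. z \<in> ball 0 1 \<Longrightarrow> G z = (1 - z / of_real p) * (1 - of_real p * z * H z)"
proof -
  let ?p = "complex_of_real p"
  have pb: "?p \<in> ball 0 1" using p by simp
  define Q where "Q = (\<lambda>z. if z = 0 then deriv G 0 else (G z - G 0) / (z - 0))"
  have Q: "Q holomorphic_on ball 0 1"
    unfolding Q_def by (intro pole_lemma_open G) auto
  have GQ: "G z = 1 + z * Q z" for z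
    by (simp add: Q_def G(2))
  have Q': "(Q has_field_derivative deriv Q z) (at z)" if "z \<in> ball 0 1" for z
    using holomorphic_derivI[OF Q _ that] by simp
  have dQ: "norm (deriv Q z) \<le> M" if "norm z < 1" for z
  proof (rule norm_le_of_weighted_bound_near_boundary[OF _ p(2) _ that])
    show "deriv Q holomorphic_on ball 0 1" by (intro holomorphic_deriv Q) auto
    fix z :: complex assume z: "p < norm z" "norm z < 1"
    have "((\<lambda>z. 1 + z * Q z) has_field_derivative (Q z + z * deriv Q z)) (at z)"
      using z by (auto intro!: derivative_eq_intros Q')
    hence "(G has_field_derivative (Q z + z * deriv Q z)) (at z)"
      by (simp add: GQ[abs_def])
    hence "G z - z * deriv G z - 1 = - (z\<^sup>2 * deriv Q z)"
      by (simp add: DERIV_imp_deriv GQ power2_eq_square algebra_simps)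
    thus "norm (z\<^sup>2 * deriv Q z) \<le> M"
      using bd[OF z] by (metis norm_minus_cancel)
  qed
  define H where "H = (\<lambda>z. if z = ?p then deriv Q ?p else (Q z - Q ?p) / (z - ?p))"
  have H: "H holomorphic_on ball 0 1"
    unfolding H_def by (intro pole_lemma_open Q) auto
  have Qp: "Q ?p = - 1 / ?p" using GQ[of ?p] G(3) p by (simp add: field_simps eq_neg_iff_add_eq_0)
  have QH: "Q z = (z - ?p) * H z - 1 / ?p" for z
    using Qp by (simp add: H_def)
  show ?thesis
  proof
    show "H holomorphic_on ball 0 1" by (fact H)
    fix z :: complex assume z: "z \<in> ball 0 1"
    show "norm (H z) \<le> M"
    proof (cases "z = ?p")
      case True
      thus ?thesis using dQ z by (simp add: H_def)
    next
      case False
      \<comment> \<open>The bound on \<open>deriv Q\<close> passes to difference quotients because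
        the disc is convex.\<close>
      have "norm (Q z - Q ?p) \<le> M * norm (z - ?p)"
        by (rule field_differentiable_bound[OF convex_ball[of 0 1] DERIV_subset[OF Q' subset_UNIV]])
           (use z pb dQ in auto)
      thus ?thesis using False by (simp add: H_def norm_divide divide_simps)
    qed
    show "G z = (1 - z / ?p) * (1 - ?p * z * H z)"
      using p by (simp add: GQ QH field_simps)
  qed
qed

text \<open>The quotient \<open>z / f z\<close>, completed by \<open>1\<close> at \<open>0\<close>
  and \<open>0\<close> at \<open>p\<close>, is holomorphic on the disc, so the preceding
  factorization applies with \<open>\<phi> = p H\<close>.\<close>

lemma class_V_factorization:
  assumes p: "0 < p" "p < 1" and lam: "lam \<le> 1" and f: "f \<in> class_V p lam"
  obtains \<phi> where "\<phi> holomorphic_on ball 0 1"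
    "\<And>z. z \<in> ball 0 1 \<Longrightarrow> norm (\<phi> z) \<le> lam * p"
    "\<And>z. z \<in> ball 0 p \<Longrightarrow> f z * (1 - z / of_real p) * (1 - z * \<phi> z) = z"
proof -
  let ?p = "complex_of_real p"
  define G where "G = (\<lambda>z. if z = 0 then 1 else if z = ?p then 0 else z / f z)"
  have an: "f analytic_on (ball 0 1 - {?p})" and pole: "is_pole f ?p"
    and f0: "f 0 = 0" "deriv f 0 = 1"
    and U: "\<And>z. z \<in> ball 0 1 \<Longrightarrow> norm (U_op p f z) < lam"
    using f by (auto simp: class_V_def class_A_def)
  have hf: "f holomorphic_on (ball 0 1 - {?p})" using an by (rule analytic_imp_holomorphic)
  have f': "(f has_field_derivative deriv f z) (at z)" if "z \<in> ball 0 1 - {?p}" for z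
    by (rule holomorphic_derivI[OF hf _ that]) auto
  have U': "norm ((z / f z)\<^sup>2 * deriv f z - 1) < lam" if "z \<in> ball 0 1 - {0,?p}" for z
    using U[of z] that by (auto simp: U_op_def)
  \<comment> \<open>At a zero of \<open>f\<close>, division by zero makes the expression equal to
    -1, whose norm 1 is not below \<open>lam\<close>.\<close>
  have nz: "f z \<noteq> 0" if "z \<in> ball 0 1 - {0,?p}" for z
    using U'[OF that] lam by auto
  have hG: "G holomorphic_on (ball 0 1 - {0,?p})"
  proof (rule holomorphic_transform)
    show "(\<lambda>z. z / f z) holomorphic_on (ball 0 1 - {0,?p})"
      using nz by (intro holomorphic_intros holomorphic_on_subset[OF hf]) auto
  qed (auto simp: G_def)
  \<comment> \<open>Continuity at \<open>0\<close> comes from \<open>deriv f 0 = 1\<close>, at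
    \<open>p\<close> from the pole; this suffices to remove both singularities.\<close>
  have "isCont G z" if z: "z \<in> ball 0 1" for z
  proof -
    consider "z = 0" | "z = ?p" | "z \<in> ball 0 1 - {0,?p}" using z by auto
    thus ?thesis
    proof cases
      case 1
      have "((\<lambda>z. f z / z) \<longlongrightarrow> 1) (at 0)"
        using f'[of 0] p f0 by (simp add: has_field_derivative_iff)
      from tendsto_inverse[OF this] have lim: "((\<lambda>z. z / f z) \<longlongrightarrow> 1) (at 0)" by simp
      have "eventually (\<lambda>z. z \<noteq> ?p) (at 0)"
        using p by (intro eventually_neq_at_within) 
      moreover have "eventually (\<lambda>z::complex. z \<noteq> 0) (at 0)"
        by (intro eventually_neq_at_within)
      ultimately have "eventually (\<lambda>z. z / f z = G z) (at 0)"
        by eventually_elim (simp add: G_def)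
      from Lim_transform_eventually[OF lim this] show ?thesis
        by (simp add: 1 isCont_def) (simp add: G_def)
    next
      case 2
      have "((\<lambda>z. inverse (f z)) \<longlongrightarrow> 0) (at ?p)"
        using pole unfolding is_pole_def by (rule filterlim_compose[OF tendsto_inverse_0])
      from tendsto_mult[OF tendsto_ident_at this]
      have lim: "((\<lambda>z. z / f z) \<longlongrightarrow> 0) (at ?p)" by (simp add: divide_inverse)
      have "eventually (\<lambda>z. z \<noteq> ?p) (at ?p)"
        by (intro eventually_neq_at_within)
      moreover have "eventually (\<lambda>z. z \<noteq> 0) (at ?p)"
        using p by (intro eventually_neq_at_within) 
      ultimately have "eventually (\<lambda>z. z / f z = G z) (at ?p)"
        by eventually_elim (simp add: G_def)
      from Lim_transform_eventually[OF lim this] show ?thesis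
        using p by (simp add: 2 isCont_def) (simp add: G_def)
    next
      case 3
      have "open (ball 0 1 - {0,?p})" by (intro open_Diff) auto
      thus ?thesis
        using 3 holomorphic_on_imp_continuous_on[OF hG] continuous_on_eq_continuous_at by blast
    qed
  qed
  hence "continuous_on (ball 0 1) G" by (simp add: continuous_at_imp_continuous_on)
  hence G: "G holomorphic_on ball 0 1"
    by (rule no_isolated_singularity[OF _ hG]) auto
  have bd: "norm (G z - z * deriv G z - 1) \<le> lam" if z: "p < norm z" "norm z < 1" for z
  proof -
    have z': "z \<in> ball 0 1 - {0,?p}" using z p by auto
    have "((\<lambda>z. z / f z) has_field_derivative (f z - z * deriv f z) / (f z)\<^sup>2) (at z)"
      using nz[OF z'] z' by (auto intro!: derivative_eq_intros f' simp: power2_eq_square)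
    hence "(G has_field_derivative (f z - z * deriv f z) / (f z)\<^sup>2) (at z)"
    proof (rule has_field_derivative_transform_within_open)
      show "open (ball 0 1 - {0,?p})" by (intro open_Diff) auto
    qed (use z' in \<open>auto simp: G_def\<close>)
    hence d: "deriv G z = (f z - z * deriv f z) / (f z)\<^sup>2" by (rule DERIV_imp_deriv)
    have "G z = z / f z" using z' by (auto simp: G_def)
    hence "G z - z * deriv G z - 1 = (z / f z)\<^sup>2 * deriv f z - 1"
      unfolding d using nz[OF z'] by (simp add: field_simps power2_eq_square)
    thus ?thesis using U'[OF z'] by simp
  qed
  have "G 0 = 1" "G ?p = 0" using p by (auto simp: G_def)
  from factorization_of_bounded_defect[OF G this p bd]
  obtain H where H: "H holomorphic_on ball 0 1" "\<And>z. z \<in> ball 0 1 \<Longrightarrow> norm (H z) \<le> lam"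
    "\<And>z. z \<in> ball 0 1 \<Longrightarrow> G z = (1 - z / ?p) * (1 - ?p * z * H z)" by blast
  show ?thesis
  proof
    show "(\<lambda>z. ?p * H z) holomorphic_on ball 0 1" by (intro holomorphic_intros H)
    show "norm (?p * H z) \<le> lam * p" if "z \<in> ball 0 1" for z
      using H(2)[OF that] p by (simp add: norm_mult mult.commute)
    \<comment> \<open>The smaller disc leaves out \<open>p\<close>, where the value of
      \<open>f\<close> is arbitrary.\<close>
    show "f z * (1 - z / ?p) * (1 - z * (?p * H z)) = z" if z: "z \<in> ball 0 p" for z
    proof (cases "z = 0")
      case False
      have z': "z \<in> ball 0 1 - {0,?p}" using z p False by auto
      hence "(1 - z / ?p) * (1 - ?p * z * H z) = z / f z"
        using H(3)[of z] by (auto simp: G_def)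
      hence "f z * ((1 - z / ?p) * (1 - ?p * z * H z)) = z" using nz[OF z'] by simp
      thus ?thesis by (simp only: mult_ac)
    qed (simp add: f0)
  qed
qed

section \<open>Passage to Taylor coefficients at the origin\<close>

lemma class_V_fps:
  assumes p: "0 < p" "p < 1" and lam: "lam \<le> 1" and f: "f \<in> class_V p lam"
  obtains \<phi> A F where "\<phi> holomorphic_on ball 0 1" "\<phi> has_fps_expansion A"
    "\<And>z. z \<in> ball 0 1 \<Longrightarrow> norm (\<phi> z) \<le> lam * p"
    "F = 1 + fps_X * A * F"
    "fps_expansion f 0 * (1 - fps_X * fps_const (1 / of_real p)) = fps_X * F"
proof -
  let ?p = "complex_of_real p" and ?E = "fps_expansion f 0"
  from class_V_factorization[OF p lam f]
  obtain \<phi> where \<phi>: "\<phi> holomorphic_on ball 0 1"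
    "\<And>z. z \<in> ball 0 1 \<Longrightarrow> norm (\<phi> z) \<le> lam * p"
    "\<And>z. z \<in> ball 0 p \<Longrightarrow> f z * (1 - z / of_real p) * (1 - z * \<phi> z) = z" by blast
  define A where "A = fps_expansion \<phi> 0"
  have A: "\<phi> has_fps_expansion A"
    unfolding A_def
    by (rule analytic_at_imp_has_fps_expansion_0)
       (rule analytic_on_subset[OF iffD2[OF analytic_on_open \<phi>(1)]], auto)
  have "f analytic_on {0}"
    using f p by (auto simp: class_V_def class_A_def elim!: analytic_on_subset)
  hence E: "f has_fps_expansion ?E" by (rule analytic_at_imp_has_fps_expansion_0)
  have "(\<lambda>z. f z * (1 - z * (1 / ?p)) * (1 - z * \<phi> z)) has_fps_expansion
          ?E * (1 - fps_X * fps_const (1 / ?p)) * (1 - fps_X * A)"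
    by (intro fps_expansion_intros E A)
  moreover have "eventually (\<lambda>z. f z * (1 - z * (1 / ?p)) * (1 - z * \<phi> z) = z) (nhds 0)"
    using eventually_nhds_in_open[of "ball 0 p" 0] p \<phi>(3) by (auto elim!: eventually_mono)
  ultimately have "(\<lambda>z. z) has_fps_expansion
          ?E * (1 - fps_X * fps_const (1 / ?p)) * (1 - fps_X * A)"
    by (subst has_fps_expansion_cong[symmetric]) auto
  hence eq: "?E * (1 - fps_X * fps_const (1 / ?p)) * (1 - fps_X * A) = fps_X"
    by (rule fps_expansion_unique_complex) (rule has_fps_expansion_fps_X)
  define F where "F = inverse (1 - fps_X * A)"
  have F: "F * (1 - fps_X * A) = 1"
    unfolding F_def by (rule inverse_mult_eq_1) simp
  show ?thesis
  proof
    show "F = 1 + fps_X * A * F" using F by (simp add: algebra_simps)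
    have "?E * (1 - fps_X * fps_const (1 / ?p)) =
            ?E * (1 - fps_X * fps_const (1 / ?p)) * (F * (1 - fps_X * A))"
      by (simp only: F mult_1_right)
    also have "\<dots> = ?E * (1 - fps_X * fps_const (1 / ?p)) * (1 - fps_X * A) * F"
      by (simp only: mult_ac)
    finally show "?E * (1 - fps_X * fps_const (1 / ?p)) = fps_X * F"
      by (simp only: eq)
  qed (use \<phi> A in auto)
qed

theorem theorem3:
  fixes p lam :: real and f :: "complex \<Rightarrow> complex"
  assumes "0 < p" and "p < 1"
    and "0 < lam" and "lam \<le> 1"
    and "f \<in> class_V p lam"
  shows "(\<forall>n\<ge>3. norm (taylor_coeff f n) \<le>
            1 / p ^ (n - 1)
            + sqrt (\<Sum>k=1..n-1. lam ^ (2 * k) * p ^ (2 * k))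
              * sqrt (\<Sum>k=1..n-1. 1 / p ^ (2 * (n - k - 1))))
       \<and> (\<forall>n\<ge>2. norm (taylor_coeff f (n + 1) - taylor_coeff f n / of_real p) \<le> lam * p)"
proof -
  note p = assms(1,2)
  let ?p = "complex_of_real p"
  obtain \<phi> A F where \<phi>: "\<phi> holomorphic_on ball 0 1" "\<phi> has_fps_expansion A"
    "\<And>z. z \<in> ball 0 1 \<Longrightarrow> norm (\<phi> z) \<le> lam * p" and F: "F = 1 + fps_X * A * F"
    and E: "fps_expansion f 0 * (1 - fps_X * fps_const (1 / ?p)) = fps_X * F"
    by (rule class_V_fps[OF p assms(4,5)]) (rule that)
  \<comment> \<open>Strictness holds even for \<open>lam = 1\<close>, because \<open>p < 1\<close>;
    the Moebius argument relies on it.\<close>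
  have mu: "0 \<le> lam * p" "lam * p < 1"
    using assms mult_right_mono[of lam 1 p] by (simp, linarith)
  have F0: "fps_nth F 0 = 1" by (subst F) simp
  have E': "fps_expansion f 0 = fps_X * (F + fps_const (1 / ?p) * fps_expansion f 0)"
    using E by (simp add: algebra_simps)
  have a0: "taylor_coeff f 0 = 0" unfolding taylor_coeff_def by (subst E') simp
  have rec: "taylor_coeff f (Suc n) = fps_nth F n + taylor_coeff f n / ?p" for n
    unfolding taylor_coeff_def by (subst E') simp
  \<comment> \<open>The recurrence unrolled. Its term \<open>k = 0\<close> is the leading
    \<open>1 / p ^ n\<close> of the first estimate; Cauchy-Schwarz handles the others.\<close>
  have a: "taylor_coeff f (Suc n) = (\<Sum>k\<le>n. fps_nth F k / ?p ^ (n - k))" for n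
  proof (induction n)
    case (Suc n)
    have "(\<Sum>k\<le>n. fps_nth F k / ?p ^ (Suc n - k)) = (\<Sum>k\<le>n. fps_nth F k / ?p ^ (n - k)) / ?p"
      by (auto simp: sum_divide_distrib Suc_diff_le intro!: sum.cong)
    thus ?case by (simp add: rec[of "Suc n"] Suc)
  qed (simp add: rec a0)
  have "norm (taylor_coeff f n) \<le> 1 / p ^ (n - 1)
            + sqrt (\<Sum>k=1..n-1. lam ^ (2 * k) * p ^ (2 * k))
              * sqrt (\<Sum>k=1..n-1. 1 / p ^ (2 * (n - k - 1)))" if "n \<ge> 3" for n
  proof -
    define m where "m = n - 1"
    have n: "n = Suc m" using that by (simp add: m_def)
    have split: "{..m} = insert 0 {1..m}" by auto
    have "norm (taylor_coeff f n) \<le> (\<Sum>k\<le>m. norm (fps_nth F k) * (1 / p ^ (m - k)))"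
      unfolding n a using p by (intro sum_norm_le) (simp add: norm_divide norm_power)
    also have "\<dots> = 1 / p ^ m + (\<Sum>k=1..m. \<bar>norm (fps_nth F k)\<bar> * \<bar>1 / p ^ (m - k)\<bar>)"
      using p by (simp add: split F0)
    also have "(\<Sum>k=1..m. \<bar>norm (fps_nth F k)\<bar> * \<bar>1 / p ^ (m - k)\<bar>)
        \<le> sqrt (\<Sum>k=1..m. (norm (fps_nth F k))\<^sup>2) * sqrt (\<Sum>k=1..m. (1 / p ^ (m - k))\<^sup>2)"
      using L2_set_mult_ineq unfolding L2_set_def .
    also have "\<dots> \<le> sqrt (\<Sum>k=1..m. (lam * p) ^ (2 * k)) * sqrt (\<Sum>k=1..m. (1 / p ^ (m - k))\<^sup>2)"
      by (intro mult_right_mono real_sqrt_le_mono sum_norm_subordinate_coeff_le[OF \<phi> F])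
         (auto intro!: sum_nonneg)
    finally show ?thesis
      by (simp add: n power_mult_distrib power_divide power_mult mult.commute)
  qed
  moreover have "norm (taylor_coeff f (n + 1) - taylor_coeff f n / ?p) \<le> lam * p" if "n \<ge> 2" for n
    using norm_subordinate_coeff_le[OF \<phi> mu F, of n] that rec[of n] by simp
  ultimately show ?thesis by blast
qed
end
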